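(* Let $X/\mathbf{F}_q$ be a geometrically connected smooth projective cellular variety. Then $Z_{\log}(X,t)$ has a (possibly multi-valued) analytic continuation.
   Context: For a variety $X/\mathbf{F}_q$ with an $\mathbf{F}_q$-rational point, the multiplicative zeta function is the power series $Z_{\log}(X,t):=\exp\left(\sum_{r\geq 1}\log|X(\mathbf{F}_{q^r})|\cdot\frac{t^r}{r}\right)$. Cellular (standard meaning): $X$ admits a finite filtration by closed subvarieties $\varnothing=X_{-1}\subset X_0\subset\cdots\subset X_n=X$, defined over $\mathbf{F}_q$, such that each $X_i\setminus X_{i-1}$ is isomorphic to a disjoint union of affine spaces over $\mathbf{F}_q$. A power series $f(t)$ with complex coefficients and positive radius of convergence has a (possibly multi-valued) analytic continuation if there exists a discrete set $\Delta\subset\mathbf{C}$, $0\notin\Delta$, such that for every simply connected domain $U$ with $0\in U\subset\mathbf{C}\setminus\Delta$ there exists a holomorphic function $f_U:U\to\mathbf{C}$ which agrees with $f$ in some neighbourhood of $t=0$. *)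

theory Defs
  imports
    "HOL-Complex_Analysis.Complex_Analysis"
    "HOL-Library.Poly_Mapping"
    "HOL-Algebra.Algebraic_Closure_Type"
begin

text \<open>
  Projective varieties over \<open>k = F\<^sub>q\<close> are treated classically: since \<open>k\<close> is perfect, a reduced
  quasi-projective \<open>k\<close>-scheme amounts to its set of geometric points, a locally closed subset of
  \<open>P\<^sup>n\<close> over the algebraic closure that is cut out by polynomials with coefficients in \<open>k\<close>, and
  morphisms over \<open>k\<close> are the maps locally given by polynomials with coefficients in \<open>k\<close>.
  Smooth schemes over a field are reduced, so nothing is lost.

  In the definitions below \<open>'a\<close> is the algebraically closed field of coordinates and \<open>F\<close> is the
  subfield from which coefficients are taken: \<open>base_field\<close> for notions over \<open>F\<^sub>q\<close>, and \<open>UNIV\<close>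
  for geometric notions.
\<close>

definition base_field :: "'k::field alg_closure set" where
  "base_field = range to_ac"


subsection \<open>Polynomials\<close>

type_synonym 'a mvpoly = "(nat \<Rightarrow>\<^sub>0 nat) \<Rightarrow>\<^sub>0 'a"

definition mv_eval :: "(nat \<Rightarrow> 'a::field) \<Rightarrow> 'a mvpoly \<Rightarrow> 'a" where
  "mv_eval v p =
     (\<Sum>m\<in>Poly_Mapping.keys p. Poly_Mapping.lookup p m *
        (\<Prod>i\<in>Poly_Mapping.keys m. v i ^ Poly_Mapping.lookup m i))"

definition mv_partial :: "nat \<Rightarrow> 'a::field mvpoly \<Rightarrow> 'a mvpoly" where
  "mv_partial j p =
     (\<Sum>m\<in>Poly_Mapping.keys p. Poly_Mapping.single (m - Poly_Mapping.single j 1)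
        (of_nat (Poly_Mapping.lookup m j) * Poly_Mapping.lookup p m))"

text \<open>Homogeneous polynomials of degree \<open>e\<close> in the variables \<open>x\<^sub>0, \<dots>, x\<^sub>n\<close> with coefficients in \<open>F\<close>;
  the zero polynomial is included for every \<open>e\<close>.\<close>

definition forms :: "'a::field set \<Rightarrow> nat \<Rightarrow> nat \<Rightarrow> 'a mvpoly set" where
  "forms F n e =
     {p. \<forall>m\<in>Poly_Mapping.keys p. Poly_Mapping.lookup p m \<in> F \<and>
           Poly_Mapping.keys m \<subseteq> {..n} \<and>
           (\<Sum>i\<in>Poly_Mapping.keys m. Poly_Mapping.lookup m i) = e}"


subsection \<open>Projective space and its Zariski topologies\<close>

text \<open>A point of \<open>P\<^sup>n\<close> is the set of all its vectors of homogeneous coordinates; coordinates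
  with index beyond \<open>n\<close> are zero.\<close>

type_synonym 'a ppoint = "(nat \<Rightarrow> 'a) set"

definition hpoint :: "nat \<Rightarrow> (nat \<Rightarrow> 'a::field) \<Rightarrow> 'a ppoint" where
  "hpoint n v = {(\<lambda>i. if i \<le> n then c * v i else 0) | c. c \<noteq> 0}"

definition proj_space :: "nat \<Rightarrow> 'a::field ppoint set" where
  "proj_space n = {hpoint n v | v. \<exists>i\<le>n. v i \<noteq> 0}"

definition vanishes_at :: "'a::field mvpoly \<Rightarrow> 'a ppoint \<Rightarrow> bool" where
  "vanishes_at p P \<longleftrightarrow> (\<forall>v\<in>P. mv_eval v p = 0)"

text \<open>The sets \<open>D(f) = {f \<noteq> 0}\<close> satisfy \<open>D(f) \<inter> D(g) = D(f g)\<close>, so they form a basis, and the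
  closed sets are exactly the common zero loci of families of forms over \<open>F\<close>.\<close>

definition zariski :: "'a::field set \<Rightarrow> nat \<Rightarrow> 'a ppoint topology" where
  "zariski F n =
     topology_generated_by {{P \<in> proj_space n. \<not> vanishes_at f P} | f e. f \<in> forms F n e}"


subsection \<open>Regular maps and affine spaces\<close>

text \<open>Regular maps over \<open>F\<close> between locally closed subsets \<open>W\<close> of \<open>P\<^sup>n\<close> and \<open>V\<close> of \<open>P\<^sup>m\<close>: locally
  around every point of \<open>W\<close> they are given by forms \<open>g\<^sub>0, \<dots>, g\<^sub>m\<close> over \<open>F\<close> of a common degree
  without common zero.\<close>

definition regular_map ::
  "'a::field set \<Rightarrow> nat \<Rightarrow> 'a ppoint set \<Rightarrow> nat \<Rightarrow> 'a ppoint set \<Rightarrow> ('a ppoint \<Rightarrow> 'a ppoint) \<Rightarrow> bool"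
  where
  "regular_map F n W m V h \<longleftrightarrow>
     h ` W \<subseteq> V \<and>
     (\<forall>P\<in>W. \<exists>U e g. openin (zariski F n) U \<and> P \<in> U \<and> (\<forall>j\<le>m. g j \<in> forms F n e) \<and>
        (\<forall>Q\<in>W \<inter> U. \<forall>v\<in>Q. (\<exists>j\<le>m. mv_eval v (g j) \<noteq> 0) \<and>
                             h Q = hpoint m (\<lambda>j. mv_eval v (g j))))"

definition isomorphic_over ::
  "'a::field set \<Rightarrow> nat \<Rightarrow> 'a ppoint set \<Rightarrow> nat \<Rightarrow> 'a ppoint set \<Rightarrow> bool" where
  "isomorphic_over F n W m V \<longleftrightarrow>
     (\<exists>h h'. regular_map F n W m V h \<and> regular_map F m V n W h' \<and>
        (\<forall>P\<in>W. h' (h P) = P) \<and> (\<forall>Q\<in>V. h (h' Q) = Q))"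

text \<open>\<open>A\<^sup>d\<close> as the standard chart \<open>x\<^sub>0 \<noteq> 0\<close> of \<open>P\<^sup>d\<close>.\<close>

definition affine_space :: "nat \<Rightarrow> 'a::field ppoint set" where
  "affine_space d = {hpoint d v | v. v 0 \<noteq> 0}"

text \<open>\<open>W\<close> is isomorphic to a finite disjoint union (coproduct) of affine spaces iff it is partitioned
  into relatively open pieces that are isomorphic to affine spaces.\<close>

definition disjoint_union_of_affine_spaces :: "'a::field set \<Rightarrow> nat \<Rightarrow> 'a ppoint set \<Rightarrow> bool" where
  "disjoint_union_of_affine_spaces F n W \<longleftrightarrow>
     (\<exists>(s::nat) U d. W = (\<Union>j<s. U j) \<and> disjoint_family_on U {..<s} \<and>
        (\<forall>j<s. openin (subtopology (zariski F n) W) (U j) \<and>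
               isomorphic_over F n (U j) (d j) (affine_space (d j))))"


subsection \<open>Properties of projective varieties\<close>

definition projective_variety :: "nat \<Rightarrow> 'k::field alg_closure ppoint set \<Rightarrow> bool" where
  "projective_variety n V \<longleftrightarrow> closedin (zariski base_field n) V"

definition geometrically_connected :: "nat \<Rightarrow> 'k::field alg_closure ppoint set \<Rightarrow> bool" where
  "geometrically_connected n V \<longleftrightarrow> V \<noteq> {} \<and> connectedin (zariski UNIV n) V"

definition irreducible_closed :: "nat \<Rightarrow> 'a::field ppoint set \<Rightarrow> bool" where
  "irreducible_closed n Z \<longleftrightarrow>
     closedin (zariski UNIV n) Z \<and> Z \<noteq> {} \<and>
     (\<forall>A B. closedin (zariski UNIV n) A \<and> closedin (zariski UNIV n) B \<and> Z \<subseteq> A \<union> B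
        \<longrightarrow> Z \<subseteq> A \<or> Z \<subseteq> B)"

text \<open>The Krull dimension of the local ring of the closed set \<open>V\<close> at \<open>P\<close>: chains of primes of this
  ring correspond to chains of irreducible closed subsets of \<open>V\<close> containing \<open>P\<close>.\<close>

definition local_dim :: "nat \<Rightarrow> 'a::field ppoint set \<Rightarrow> 'a ppoint \<Rightarrow> enat" where
  "local_dim n V P =
     Sup {enat l | l. \<exists>Z. (\<forall>i\<le>l. irreducible_closed n (Z i) \<and> P \<in> Z i \<and> Z i \<subseteq> V) \<and>
                          (\<forall>i<l. Z i \<subset> Z (Suc i))}"

text \<open>The Jacobian criterion at every geometric point. The generators of the homogeneous ideal of
  \<open>V\<close> may be taken to be all forms vanishing on \<open>V\<close>. By Euler's identity the common kernel of their
  gradients in \<open>n + 1\<close> variables contains the coordinate vector \<open>v\<close> itself, in every characteristic;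
  it has dimension \<open>dim T\<^sub>P V + 1\<close>, so the rank has to be \<open>n - dim\<^sub>P V\<close> just as in an affine chart.
  Gradients are vectors of type \<open>nat \<Rightarrow>\<^sub>0 'a\<close>.\<close>

definition jacobian_rank :: "nat \<Rightarrow> 'a::field ppoint set \<Rightarrow> (nat \<Rightarrow> 'a) \<Rightarrow> nat" where
  "jacobian_rank n V v =
     vector_space.dim (\<lambda>c. Poly_Mapping.map ((*) c))
       {(\<Sum>j\<le>n. Poly_Mapping.single j (mv_eval v (mv_partial j f))) | f e.
          f \<in> forms UNIV n e \<and> (\<forall>Q\<in>V. vanishes_at f Q)}"

definition smooth :: "nat \<Rightarrow> 'k::field alg_closure ppoint set \<Rightarrow> bool" where
  "smooth n V \<longleftrightarrow>
     (\<forall>P\<in>V. \<forall>v\<in>P. enat (jacobian_rank n V v) + local_dim n V P = enat n)"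

text \<open>The filtration is shifted by one: \<open>Y i\<close> is \<open>V\<^bsub>i-1\<^esub>\<close>.\<close>

definition cellular :: "nat \<Rightarrow> 'k::field alg_closure ppoint set \<Rightarrow> bool" where
  "cellular n V \<longleftrightarrow>
     (\<exists>l Y. Y 0 = {} \<and> Y (Suc l) = V \<and>
        (\<forall>i\<le>Suc l. closedin (zariski base_field n) (Y i)) \<and>
        (\<forall>i\<le>l. Y i \<subseteq> Y (Suc i) \<and>
                disjoint_union_of_affine_spaces base_field n (Y (Suc i) - Y i)))"


subsection \<open>The multiplicative zeta function\<close>

text \<open>\<open>V(F\<^bsub>q^r\<^esub>)\<close>, for \<open>r \<ge> 1\<close>, consists of the points having homogeneous coordinates in the unique
  subfield of order \<open>q\<^sup>r\<close> of the algebraic closure, which is the set of roots of \<open>x\<^bsup>q^r\<^esup> = x\<close>.\<close>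

definition rational_points ::
  "nat \<Rightarrow> 'k::{field,finite} alg_closure ppoint set \<Rightarrow> 'k alg_closure ppoint set" where
  "rational_points r V = {P \<in> V. \<exists>v\<in>P. \<forall>i. v i ^ (CARD('k) ^ r) = v i}"

definition Zlog :: "'k::{field,finite} alg_closure ppoint set \<Rightarrow> complex fps" where
  "Zlog V = fps_compose (fps_exp 1)
     (Abs_fps (\<lambda>r. if r = 0 then 0
                   else complex_of_real (ln (real (card (rational_points r V))) / real r)))"


subsection \<open>Multi-valued analytic continuation\<close>

text \<open>``Discrete'' has to mean closed and discrete: for a set such as \<open>{1/n | n \<ge> 1}\<close>, which is discrete
  in the subspace topology only, no domain \<open>U\<close> as below exists and the condition would be void.\<close>

definition has_multivalued_continuation :: "complex fps \<Rightarrow> bool" where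
  "has_multivalued_continuation f \<longleftrightarrow>
     fps_conv_radius f > 0 \<and>
     (\<exists>\<Delta>. closed \<Delta> \<and> discrete \<Delta> \<and> 0 \<notin> \<Delta> \<and>
        (\<forall>U. open U \<and> connected U \<and> simply_connected U \<and> 0 \<in> U \<and> U \<subseteq> - \<Delta> \<longrightarrow>
           (\<exists>g. g holomorphic_on U \<and> (\<forall>\<^sub>F z in nhds 0. g z = eval_fps f z))))"

end

theory Submission
  imports Defs
begin

text \<open>
  The cells of \<open>V\<close> are affine spaces, so \<open>|V(F\<^bsub>q^r\<^esub>)| = \<Sum>\<^sub>d q\<^bsup>rd\<^esup>\<close>, where \<open>d\<close> runs through the dimensions
  of the cells; see \<open>counted_by_cells_cellular\<close>. This rests on three facts: rational points are additive
  over the cells, isomorphisms over \<open>F\<^sub>q\<close> preserve them, and the fixed field of the \<open>r\<close>-th power of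
  Frobenius has exactly \<open>q\<^sup>r\<close> elements. Since \<open>V\<close> is nonempty, there is at least one cell.

  Let \<open>D\<close> be the largest dimension of a cell. Then
  \<open>ln |V(F\<^bsub>q^r\<^esub>)| = r D ln q + \<phi>(q\<^bsup>-r\<^esup>)\<close>, where \<open>\<phi>\<close> is the logarithm of a polynomial with positive constant
  term and hence has a Taylor expansion \<open>\<phi>(u) = \<Sum>\<^sub>k c\<^sub>k u\<^sup>k\<close> at \<open>0\<close>. The exponent of the zeta function has
  logarithmic singularities, but its derivative \<open>\<Sum>\<^sub>r ln |V(F\<^bsub>q^(r+1)\<^esub>)| t\<^sup>r\<close> is single-valued. Formally,
  interchanging the sums over \<open>r\<close> and \<open>k\<close> gives
  \<open>D ln q / (1 - t)\<^sup>2 + \<Sum>\<^sub>k c\<^sub>k q\<^bsup>-k\<^esup> / (1 - q\<^bsup>-k\<^esup> t)\<close>. After removing finitely many powers of \<open>t\<close> from the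
  series in order to ensure convergence, this is a function that is holomorphic on the whole plane except for
  the points \<open>q\<^sup>k\<close> with \<open>k \<ge> 0\<close>; see \<open>log_polynomial_series_continuation\<close>.

  These points form a closed discrete set that does not contain \<open>0\<close>. On any simply connected domain that
  contains \<open>0\<close> and avoids them, the derivative has a primitive vanishing at \<open>0\<close>, and the exponential of
  this primitive continues the zeta function; see \<open>exp_primitive_multivalued_continuation\<close>.
\<close>

section \<open>Frobenius on the algebraic closure of a finite field\<close>

lemma power_card_eq_self:
  fixes x :: "'k::{field,finite}"
  shows "x ^ CARD('k) = x"
proof (cases "x = 0")
  case False
  have "bij_betw (\<lambda>y. x * y) (UNIV - {0}) (UNIV - {0})"
    using False by (intro bij_betwI[of _ _ _ "\<lambda>y. y / x"]) auto
  hence "(\<Prod>y\<in>UNIV - {0}. x * y) = \<Prod>(UNIV - {0})"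
    by (rule prod.reindex_bij_betw)
  hence "x ^ (CARD('k) - 1) * \<Prod>(UNIV - {0}) = \<Prod>(UNIV - {0::'k})"
    by (simp add: prod.distrib)
  hence "x ^ (CARD('k) - 1) = 1"
    by (simp add: prod_zero_iff)
  moreover have "x ^ CARD('k) = x * x ^ (CARD('k) - 1)"
    by (metis finite power_eq_if card_gt_0_iff empty_not_UNIV less_not_refl)
  ultimately show ?thesis by simp
qed (simp add: power_0_left)

lemma card_field_ge_2: "CARD('k::{field,finite}) \<ge> 2"
  using card_mono[of "UNIV::'k set" "{0, 1}"] by simp

text \<open>
  The reason is a count of roots: since \<open>x\<^bsup>q\<^esup> = x\<close> on the field, the polynomial
  \<open>(X + 1)\<^bsup>q\<^esup> - X\<^bsup>q\<^esup> - 1\<close>, whose degree is less than \<open>q\<close>, has all \<open>q\<close> elements as roots. These binomial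
  coefficients are the obstruction to the additivity of \<open>x \<mapsto> x\<^bsup>q\<^esup>\<close> on the algebraic closure.
\<close>

lemma card_field_choose_eq_0:
  assumes "0 < k" "k < CARD('k)"
  shows "of_nat (CARD('k) choose k) = (0::'k::{field,finite})"
proof -
  define q where "q = CARD('k)"
  define p :: "'k poly" where "p = (\<Sum>i\<in>{0<..<q}. Polynomial.monom (of_nat (q choose i)) i)"
  have q: "q \<ge> 2" unfolding q_def by (rule card_field_ge_2)
  have "poly p x = 0" for x
  proof -
    have "x + 1 = (x + 1) ^ q"
      unfolding q_def by (rule power_card_eq_self[symmetric])
    also have "\<dots> = (\<Sum>i\<le>q. of_nat (q choose i) * x ^ i)"
      by (simp add: binomial_ring)
    also have "{..q} = insert 0 (insert q {0<..<q})"
      using q by auto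
    also have "(\<Sum>i\<in>\<dots>. of_nat (q choose i) * x ^ i) = 1 + x ^ q + poly p x"
      using q by (simp add: p_def poly_sum poly_monom)
    finally show ?thesis
      by (simp add: q_def power_card_eq_self)
  qed
  moreover have "Polynomial.degree p < q"
    unfolding p_def using q by (intro degree_sum_less) (auto intro: le_less_trans[OF degree_monom_le])
  ultimately have "p = 0"
    by (intro poly_eqI_degree[of UNIV]) (auto simp: q_def)
  moreover have "poly.coeff p k = of_nat (q choose k)"
    using assms by (simp add: p_def coeff_sum q_def)
  ultimately show ?thesis by (simp add: q_def)
qed

lemma frobenius_add:
  fixes x y :: "'k::{field,finite} alg_closure"
  shows "(x + y) ^ (CARD('k) ^ r) = x ^ (CARD('k) ^ r) + y ^ (CARD('k) ^ r)"
proof (induction r)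
  case (Suc r)
  define q where "q = CARD('k)"
  have q: "q \<ge> 2" unfolding q_def by (rule card_field_ge_2)
  have *: "(u + v) ^ q = u ^ q + v ^ q" for u v :: "'k alg_closure"
  proof -
    have "(u + v) ^ q = (\<Sum>i\<le>q. of_nat (q choose i) * u ^ i * v ^ (q - i))"
      by (rule binomial_ring)
    also have "\<dots> = (\<Sum>i\<in>{0, q}. of_nat (q choose i) * u ^ i * v ^ (q - i))"
    proof (rule sum.mono_neutral_right)
      show "\<forall>i\<in>{..q} - {0, q}. of_nat (q choose i) * u ^ i * v ^ (q - i) = 0"
      proof
        fix i assume "i \<in> {..q} - {0, q}"
        hence "to_ac (of_nat (q choose i) :: 'k) = 0"
          unfolding q_def by (subst card_field_choose_eq_0) auto
        thus "of_nat (q choose i) * u ^ i * v ^ (q - i) = 0" by simp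
      qed
    qed auto
    finally show ?thesis using q by simp
  qed
  show ?case
    using Suc *[unfolded q_def] by (simp add: power_mult mult.commute[of "CARD('k)"])
qed simp

lemma frobenius_sum:
  fixes f :: "'b \<Rightarrow> 'k::{field,finite} alg_closure"
  shows "(\<Sum>i\<in>A. f i) ^ (CARD('k) ^ r) = (\<Sum>i\<in>A. f i ^ (CARD('k) ^ r))"
  by (induction A rule: infinite_finite_induct) (auto simp: frobenius_add power_0_left)

lemma frobenius_base_field:
  assumes "x \<in> (base_field :: 'k::{field,finite} alg_closure set)"
  shows "x ^ (CARD('k) ^ r) = x"
proof -
  obtain y :: 'k where "x = to_ac y"
    using assms by (auto simp: base_field_def)
  moreover have "y ^ (CARD('k) ^ r) = y"
    by (induction r) (simp_all add: power_card_eq_self power_mult)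
  ultimately show ?thesis
    by (simp flip: to_ac_power)
qed

text \<open>
  The polynomial \<open>X\<^bsup>Q\<^esup> - X\<close> with \<open>Q = q\<^bsup>r\<^esup>\<close> splits over the algebraic closure. It has no repeated
  root, because its derivative is the constant \<open>-1\<close>.
\<close>

lemma card_frobenius_fixed_field:
  assumes "r > 0"
  shows "card {x :: 'k::{field,finite} alg_closure. x ^ (CARD('k) ^ r) = x} = CARD('k) ^ r"
proof -
  define Q where "Q = CARD('k) ^ r"
  have q: "CARD('k) \<ge> 2" by (rule card_field_ge_2)
  have "Q > 1"
    unfolding Q_def using q assms by (intro one_less_power) auto
  have "of_nat Q = (0 :: 'k alg_closure)"
  proof -
    have "of_nat CARD('k) = (0 :: 'k)"
      using card_field_choose_eq_0[of 1, where ?'k='k] q by simp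
    hence "to_ac (of_nat CARD('k) :: 'k) = 0" by (simp only: to_ac_0)
    thus ?thesis using assms by (simp add: Q_def)
  qed
  define p :: "'k alg_closure poly" where "p = Polynomial.monom 1 Q - [:0, 1:]"
  have deg: "Polynomial.degree p = Q"
    unfolding p_def using \<open>Q > 1\<close> by (subst diff_conv_add_uminus, subst degree_add_eq_left) (auto simp: degree_monom_eq)
  have poly_p: "poly p x = x ^ Q - x" for x
    by (simp add: p_def poly_monom)
  have "p \<noteq> 0" using deg \<open>Q > 1\<close> by auto
  have pderiv: "pderiv p = [:-1:]"
    using \<open>of_nat Q = 0\<close> by (simp add: p_def pderiv_diff pderiv_monom pderiv_pCons)
  obtain A where A: "size A = Polynomial.degree p" "p = Polynomial.smult (Polynomial.lead_coeff p) (\<Prod>x\<in>#A. [:-x, 1:])"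
    using alg_closed_imp_factorization[OF \<open>p \<noteq> 0\<close>] by blast
  have roots: "poly p x = 0 \<longleftrightarrow> x \<in># A" for x
  proof -
    have "poly p x = Polynomial.lead_coeff p * (\<Prod>y\<in>#A. x - y)"
      by (subst A(2)) (simp add: poly_prod_mset image_mset.compositionality o_def)
    thus ?thesis using \<open>p \<noteq> 0\<close> by (auto simp: prod_mset_zero_iff)
  qed
  have mult_le_1: "count A x \<le> 1" for x
  proof (rule ccontr)
    assume "\<not> count A x \<le> 1"
    hence "replicate_mset 2 x \<subseteq># A"
      by (subst count_le_replicate_mset_subset_eq[symmetric]) simp
    then obtain B where "A = replicate_mset 2 x + B"
      by (auto simp: mset_subset_eq_exists_conv)
    hence "A = add_mset x (add_mset x B)"
      by (simp add: numeral_2_eq_2)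
    hence "p = [:-x, 1:] * ([:-x, 1:] * Polynomial.smult (Polynomial.lead_coeff p) (\<Prod>y\<in>#B. [:-y, 1:]))"
      using A(2) by simp
    then obtain s where s: "p = [:-x, 1:] * ([:-x, 1:] * s)" by blast
    have "poly (pderiv p) x = 0"
      unfolding s pderiv_mult by simp
    thus False by (simp add: pderiv)
  qed
  have "A = mset_set (set_mset A)"
  proof (rule multiset_eqI)
    fix x
    show "count A x = count (mset_set (set_mset A)) x"
    proof (cases "x \<in># A")
      case True
      with mult_le_1[of x] have "count A x = 1"
        by (metis One_nat_def Suc_leI antisym count_greater_zero_iff)
      with True show ?thesis by simp
    next
      case False
      thus ?thesis by (simp add: not_in_iff)
    qed
  qed
  hence "card (set_mset A) = size A"
    by (metis size_mset_set)
  also have "set_mset A = {x. x ^ Q = x}"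
    using roots poly_p by auto
  finally show ?thesis
    using A(1) deg by (simp add: Q_def)
qed

section \<open>Rational points of affine spaces\<close>

lemma mv_eval_frobenius_fixed:
  fixes v :: "nat \<Rightarrow> 'k::{field,finite} alg_closure"
  assumes p: "\<And>m. m \<in> Poly_Mapping.keys p \<Longrightarrow> Poly_Mapping.lookup p m \<in> base_field"
    and v: "\<And>i. v i ^ (CARD('k) ^ r) = v i"
  shows "mv_eval v p ^ (CARD('k) ^ r) = mv_eval v p"
proof -
  have "(v i ^ e) ^ (CARD('k) ^ r) = v i ^ e" for i e
    by (metis v power_mult mult.commute)
  thus ?thesis
    unfolding mv_eval_def frobenius_sum power_mult_distrib prod_power_distrib
    by (intro sum.cong) (auto simp: frobenius_base_field[OF p])
qed

lemma rational_points_subset: "rational_points r V \<subseteq> V"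
  by (auto simp: rational_points_def)

text \<open>
  Forms over the base field commute with the Frobenius map, so they send coordinate vectors over
  \<open>F\<^bsub>q^r\<^esub>\<close> to coordinate vectors over \<open>F\<^bsub>q^r\<^esub>\<close>. Consequently isomorphisms over the base field preserve
  the number of points over each \<open>F\<^bsub>q^r\<^esub>\<close>.
\<close>

lemma regular_map_rational_points:
  fixes W :: "'k::{field,finite} alg_closure ppoint set"
  assumes h: "regular_map base_field n W m V h" and P: "P \<in> rational_points r W"
  shows "h P \<in> rational_points r V"
proof -
  from P obtain v where v: "P \<in> W" "v \<in> P" "\<And>i. v i ^ (CARD('k) ^ r) = v i"
    by (auto simp: rational_points_def)
  from h v(1) obtain U e g where g: "P \<in> U" "\<And>j. j \<le> m \<Longrightarrow> g j \<in> forms base_field n e"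
    "\<forall>Q\<in>W \<inter> U. \<forall>v\<in>Q. h Q = hpoint m (\<lambda>j. mv_eval v (g j))"
    unfolding regular_map_def by meson
  define w where "w j = (if j \<le> m then mv_eval v (g j) else 0)" for j
  have "h P = hpoint m (\<lambda>j. mv_eval v (g j))"
    using g(1,3) v by blast
  moreover have "w \<in> hpoint m (\<lambda>j. mv_eval v (g j))"
    unfolding hpoint_def w_def by (intro CollectI exI[of _ 1]) auto
  ultimately have "w \<in> h P" by simp
  moreover have "w j ^ (CARD('k) ^ r) = w j" for j
    using g(2)[of j] v(3) unfolding w_def
    by (auto simp: forms_def power_0_left intro!: mv_eval_frobenius_fixed)
  moreover have "h P \<in> V"
    using h v(1) by (auto simp: regular_map_def)
  ultimately show ?thesis by (auto simp: rational_points_def)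
qed

lemma isomorphic_over_rational_points:
  fixes W :: "'k::{field,finite} alg_closure ppoint set"
  assumes "isomorphic_over base_field n W m V"
  obtains h where "bij_betw h (rational_points r W) (rational_points r V)"
proof -
  from assms obtain h h' where
    h: "regular_map base_field n W m V h" "regular_map base_field m V n W h'"
    and inv: "\<And>P. P \<in> W \<Longrightarrow> h' (h P) = P" "\<And>Q. Q \<in> V \<Longrightarrow> h (h' Q) = Q"
    unfolding isomorphic_over_def by metis
  have "bij_betw h (rational_points r W) (rational_points r V)"
    using inv by (intro bij_betwI[of _ _ _ h'])
      (auto intro: regular_map_rational_points[OF h(1)] regular_map_rational_points[OF h(2)]
            dest: rational_points_subset[THEN subsetD])
  thus ?thesis by (rule that)
qed

lemma hpoint_cong:
  assumes "\<And>i. i \<le> n \<Longrightarrow> v i = w i"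
  shows "hpoint n v = hpoint n w"
proof -
  have "(\<lambda>i. if i \<le> n then c * v i else 0) = (\<lambda>i. if i \<le> n then c * w i else 0)" for c
    using assms by auto
  thus ?thesis by (simp add: hpoint_def)
qed

lemma hpoint_scale:
  assumes "c \<noteq> 0"
  shows "hpoint n (\<lambda>i. c * v i) = hpoint n v"
proof
  show "hpoint n (\<lambda>i. c * v i) \<subseteq> hpoint n v"
  proof
    fix w assume "w \<in> hpoint n (\<lambda>i. c * v i)"
    then obtain b where "b \<noteq> 0" "w = (\<lambda>i. if i \<le> n then b * (c * v i) else 0)"
      by (auto simp: hpoint_def)
    with assms show "w \<in> hpoint n v"
      unfolding hpoint_def by (intro CollectI exI[of _ "b * c"]) (auto simp: mult.assoc)
  qed
  show "hpoint n v \<subseteq> hpoint n (\<lambda>i. c * v i)"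
  proof
    fix w assume "w \<in> hpoint n v"
    then obtain b where "b \<noteq> 0" "w = (\<lambda>i. if i \<le> n then b * v i else 0)"
      by (auto simp: hpoint_def)
    with assms show "w \<in> hpoint n (\<lambda>i. c * v i)"
      unfolding hpoint_def by (intro CollectI exI[of _ "b / c"]) (auto simp: fun_eq_iff)
  qed
qed

text \<open>
  Scaling the coordinate with index \<open>0\<close> to \<open>1\<close> identifies the rational points of \<open>A\<^sup>d\<close> with the
  \<open>d\<close>-tuples over \<open>F\<^bsub>q^r\<^esub>\<close>. If some coordinate vector of the point is rational, then so is the scaled
  one.
\<close>

lemma affine_space_rational_points:
  fixes d :: nat
  defines "A \<equiv> affine_space d :: 'k::{field,finite} alg_closure ppoint set"
  assumes r: "r > 0"
  shows "finite (rational_points r A)" "card (rational_points r A) = (CARD('k) ^ r) ^ d"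
proof -
  define Q where "Q = CARD('k) ^ r"
  define K where "K = {x :: 'k alg_closure. x ^ Q = x}"
  have cardK: "card K = Q"
    unfolding K_def Q_def using r by (rule card_frobenius_fixed_field)
  have "Q > 0" by (simp add: Q_def)
  with cardK have "finite K" using card_ge_0_finite by metis
  define E where "E = ({1..d} \<rightarrow>\<^sub>E K)"
  define f :: "(nat \<Rightarrow> 'k alg_closure) \<Rightarrow> 'k alg_closure ppoint"
    where "f w = hpoint d (w(0 := 1))" for w
  have "inj_on f E"
  proof (rule inj_onI)
    fix u w assume u: "u \<in> E" and w: "w \<in> E" and eq: "f u = f w"
    have "(\<lambda>i. if i \<le> d then (u(0 := 1)) i else 0) \<in> f u"
      unfolding f_def hpoint_def by (intro CollectI exI[of _ 1]) auto
    then obtain c where c: "(\<lambda>i. if i \<le> d then (u(0 := 1)) i else 0) = (\<lambda>i. if i \<le> d then c * (w(0 := 1)) i else 0)"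
      unfolding eq unfolding f_def hpoint_def by blast
    from fun_cong[OF c, of 0] have "c = 1" by simp
    with fun_cong[OF c] have "u i = w i" if "i \<in> {1..d}" for i
      using that by (metis One_nat_def atLeastAtMost_iff fun_upd_apply mult_1 not_one_le_zero)
    with u w show "u = w"
      unfolding E_def by (rule PiE_ext)
  qed
  moreover have "f ` E = rational_points r A"
  proof (intro equalityI subsetI)
    fix P assume "P \<in> f ` E"
    then obtain w where w: "w \<in> E" "P = f w" by auto
    let ?v = "\<lambda>i. if i \<le> d then (w(0 := 1)) i else 0"
    have "?v \<in> P"
      unfolding w f_def hpoint_def by (intro CollectI exI[of _ 1]) auto
    moreover have "?v i ^ Q = ?v i" for i
      using w(1) \<open>Q > 0\<close> by (cases "i \<in> {1..d}") (auto simp: E_def K_def PiE_iff power_0_left)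
    moreover have "P \<in> A"
      unfolding A_def affine_space_def w f_def by (intro CollectI exI[of _ "w(0 := 1)"]) auto
    ultimately show "P \<in> rational_points r A"
      unfolding rational_points_def Q_def[symmetric] by (intro CollectI conjI bexI[of _ ?v] allI)
  next
    fix P assume "P \<in> rational_points r A"
    then obtain v u where v: "P = hpoint d v" "v 0 \<noteq> 0" and u: "u \<in> P" "\<And>i. u i ^ Q = u i"
      by (auto simp: rational_points_def A_def affine_space_def Q_def)
    from u(1) obtain c where c: "c \<noteq> 0" "u = (\<lambda>i. if i \<le> d then c * v i else 0)"
      by (auto simp: v hpoint_def)
    define w where "w = (\<lambda>i\<in>{1..d}. v i / v 0)"
    have "v i / v 0 = u i / u 0" if "i \<le> d" for i
      using c that by simp
    hence "w \<in> E"
      using u(2) unfolding E_def w_def by (intro PiE_I) (auto simp: K_def power_divide)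
    moreover have "P = f w"
    proof -
      have "(w(0 := 1)) i = v i / v 0" if "i \<le> d" for i
        using that v(2) by (auto simp: w_def)
      hence "f w = hpoint d (\<lambda>i. inverse (v 0) * v i)"
        unfolding f_def by (intro hpoint_cong) (simp add: field_simps)
      also have "\<dots> = P"
        unfolding v using v(2) by (intro hpoint_scale) simp
      finally show ?thesis ..
    qed
    ultimately show "P \<in> f ` E" by blast
  qed
  ultimately have bij: "bij_betw f E (rational_points r A)"
    by (simp add: bij_betw_def)
  have "finite E" unfolding E_def using \<open>finite K\<close> by (intro finite_PiE) auto
  with bij show "finite (rational_points r A)" by (simp add: bij_betw_finite)
  have "card E = Q ^ d"
    unfolding E_def by (simp add: card_PiE cardK)
  with bij show "card (rational_points r A) = (CARD('k) ^ r) ^ d"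
    by (simp add: bij_betw_same_card Q_def)
qed

section \<open>Counting points of cellular varieties\<close>

text \<open>
  \<open>ds\<close> is the list of the dimensions of the cells. The first clause ensures that a
  nonempty \<open>W\<close> has at least one cell, so that all its point counts are positive and have a logarithm.
\<close>

definition counted_by_cells :: "'k::{field,finite} alg_closure ppoint set \<Rightarrow> nat list \<Rightarrow> bool" where
  "counted_by_cells W ds \<longleftrightarrow> (ds = [] \<longrightarrow> W = {}) \<and>
     (\<forall>r>0. finite (rational_points r W) \<and>
        card (rational_points r W) = (\<Sum>d\<leftarrow>ds. (CARD('k) ^ r) ^ d))"

lemma counted_by_cells_empty: "counted_by_cells {} []"
  by (simp add: counted_by_cells_def rational_points_def)

lemma counted_by_cells_Un:
  assumes "counted_by_cells V ds" "counted_by_cells W es" "V \<inter> W = {}"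
  shows "counted_by_cells (V \<union> W) (ds @ es)"
proof -
  have "rational_points r (V \<union> W) = rational_points r V \<union> rational_points r W" for r
    by (auto simp: rational_points_def)
  moreover have "rational_points r V \<inter> rational_points r W = {}" for r
    using assms(3) by (auto simp: rational_points_def)
  ultimately show ?thesis
    using assms(1,2) by (auto simp: counted_by_cells_def card_Un_disjoint)
qed

lemma counted_by_cells_affine:
  fixes W :: "'k::{field,finite} alg_closure ppoint set"
  assumes "isomorphic_over base_field n W d (affine_space d)"
  shows "counted_by_cells W [d]"
  unfolding counted_by_cells_def
proof (intro conjI allI impI)
  fix r :: nat assume "r > 0"
  obtain h where "bij_betw h (rational_points r W)
      (rational_points r (affine_space d :: 'k alg_closure ppoint set))"
    using isomorphic_over_rational_points[OF assms] by blast
  with affine_space_rational_points[OF \<open>r > 0\<close>, of d, where ?'k = 'k]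
  show "finite (rational_points r W)"
    "card (rational_points r W) = (\<Sum>d\<leftarrow>[d]. (CARD('k) ^ r) ^ d)"
    by (auto simp: bij_betw_finite bij_betw_same_card)
qed auto

lemma counted_by_cells_disjoint_union:
  fixes W :: "'k::{field,finite} alg_closure ppoint set"
  assumes "disjoint_union_of_affine_spaces base_field n W"
  shows "\<exists>ds. counted_by_cells W ds"
proof -
  from assms obtain s :: nat and U d where
    U: "W = (\<Union>j<s. U j)" "disjoint_family_on U {..<s}"
       "\<And>j. j < s \<Longrightarrow> isomorphic_over base_field n (U j) (d j) (affine_space (d j))"
    unfolding disjoint_union_of_affine_spaces_def by blast
  have "counted_by_cells (\<Union>j<t. U j) (map d [0..<t])" if "t \<le> s" for t
    using that
  proof (induction t)
    case (Suc t)
    have "(\<Union>j<t. U j) \<inter> U t = {}"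
    proof -
      have "U j \<inter> U t = {}" if "j < t" for j
        using disjoint_family_onD[OF U(2), of j t] that Suc.prems by simp
      thus ?thesis by blast
    qed
    moreover have "counted_by_cells (\<Union>j<t. U j) (map d [0..<t])"
      using Suc by simp
    moreover have "counted_by_cells (U t) [d t]"
      using U(3)[of t] Suc.prems by (intro counted_by_cells_affine) auto
    ultimately show ?case
      using counted_by_cells_Un by (fastforce simp: lessThan_Suc Un_commute)
  qed (simp add: counted_by_cells_empty)
  thus ?thesis unfolding U(1) by blast
qed

lemma counted_by_cells_cellular:
  assumes "cellular n V"
  shows "\<exists>ds. counted_by_cells V ds"
proof -
  from assms obtain l Y where Y: "Y 0 = {}" "Y (Suc l) = V"
    "\<And>i. i \<le> l \<Longrightarrow> Y i \<subseteq> Y (Suc i)"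
    "\<And>i. i \<le> l \<Longrightarrow> disjoint_union_of_affine_spaces base_field n (Y (Suc i) - Y i)"
    unfolding cellular_def by blast
  have "\<exists>ds. counted_by_cells (Y i) ds" if "i \<le> Suc l" for i
    using that
  proof (induction i)
    case 0
    show ?case using counted_by_cells_empty Y(1) by auto
  next
    case (Suc i)
    then obtain ds where "counted_by_cells (Y i) ds" by auto
    moreover obtain es where "counted_by_cells (Y (Suc i) - Y i) es"
      using Y(4)[of i] Suc.prems counted_by_cells_disjoint_union by auto
    ultimately have "counted_by_cells (Y i \<union> (Y (Suc i) - Y i)) (ds @ es)"
      by (rule counted_by_cells_Un) auto
    thus ?case using Y(3)[of i] Suc.prems by (auto simp: Un_absorb1)
  qed
  thus ?thesis using Y(2) by blast
qed

section \<open>Lambert series\<close>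

text \<open>
  Near any point of \<open>S\<close> all but finitely many denominators have absolute value at least \<open>1/2\<close>,
  because \<open>x\<^sup>k \<rightarrow> 0\<close>. Hence the series converges locally uniformly.
\<close>

lemma holomorphic_lambert_series:
  fixes b :: "nat \<Rightarrow> complex" and x :: complex
  assumes b: "summable (\<lambda>k. norm (b k))" and x: "norm x < 1"
    and S: "open S" "\<And>z k. z \<in> S \<Longrightarrow> x ^ k * z \<noteq> 1"
  shows "(\<lambda>z. suminf (\<lambda>k. b k / (1 - x ^ k * z))) holomorphic_on S"
proof (rule holomorphic_uniform_sequence[OF S(1)])
  show "(\<lambda>z. \<Sum>k<n. b k / (1 - x ^ k * z)) holomorphic_on S" for n
    using S(2) by (intro holomorphic_intros) fastforce
next
  fix z assume "z \<in> S"
  then obtain d where d: "d > 0" "cball z d \<subseteq> S"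
    using S(1) open_contains_cball by blast
  define R where "R = norm z + d"
  have R: "R > 0" using d by (auto simp: R_def intro: add_nonneg_pos)
  have "(\<lambda>k. norm x ^ k) \<longlonglongrightarrow> 0"
    using x by (intro LIMSEQ_power_zero) auto
  hence "\<forall>\<^sub>F k in sequentially. norm x ^ k < 1 / (2 * R)"
    by (rule order_tendstoD) (use R in auto)
  hence "\<forall>\<^sub>F k in sequentially. \<forall>w\<in>cball z d. norm (b k / (1 - x ^ k * w)) \<le> 2 * norm (b k)"
  proof eventually_elim
    case (elim k)
    show ?case
    proof
      fix w assume "w \<in> cball z d"
      hence "norm w \<le> R"
        unfolding R_def by (metis (no_types) add_left_mono dist_norm mem_cball norm_minus_commute norm_triangle_sub order_trans)
      hence "norm (x ^ k * w) \<le> norm x ^ k * R"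
        by (simp add: norm_mult norm_power mult_left_mono)
      also have "\<dots> \<le> 1 / 2"
        using elim R by (simp add: field_simps)
      finally have "norm (1 - x ^ k * w) \<ge> 1 / 2"
        using norm_triangle_ineq2[of 1 "x ^ k * w"] by simp
      hence "norm (b k) * (1 / 2) \<le> norm (b k) * norm (1 - x ^ k * w)"
        by (intro mult_left_mono) auto
      moreover have "norm (1 - x ^ k * w) > 0"
        using \<open>norm (1 - x ^ k * w) \<ge> 1 / 2\<close> by linarith
      ultimately show "norm (b k / (1 - x ^ k * w)) \<le> 2 * norm (b k)"
        by (simp add: norm_divide divide_le_eq mult_ac)
    qed
  qed
  moreover have "summable (\<lambda>k. 2 * norm (b k))"
    using b by (rule summable_mult)
  ultimately have "uniform_limit (cball z d) (\<lambda>n z. \<Sum>k<n. b k / (1 - x ^ k * z))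
      (\<lambda>z. suminf (\<lambda>k. b k / (1 - x ^ k * z))) sequentially"
    by (rule Weierstrass_m_test_ev)
  with d show "\<exists>d>0. cball z d \<subseteq> S \<and> uniform_limit (cball z d)
      (\<lambda>n z. \<Sum>k<n. b k / (1 - x ^ k * z)) (\<lambda>z. suminf (\<lambda>k. b k / (1 - x ^ k * z))) sequentially"
    by blast
qed

text \<open>
  Expand every summand into a geometric series. The two summations may be interchanged because
  stopping the geometric series after \<open>J\<close> terms leaves the remainder
  \<open>\<Sum>\<^sub>k b\<^sub>k (x\<^sup>k z)\<^sup>J / (1 - x\<^sup>k z)\<close>, which is \<open>O(|z|\<^sup>J)\<close>.
\<close>

lemma lambert_series_power_series:
  fixes b :: "nat \<Rightarrow> complex" and x z :: complex
  assumes b: "summable (\<lambda>k. norm (b k))" and x: "norm x \<le> 1" and z: "norm z < 1"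
  shows "(\<lambda>j. suminf (\<lambda>k. b k * (x ^ k) ^ j) * z ^ j) sums suminf (\<lambda>k. b k / (1 - x ^ k * z))"
proof -
  define C where "C = suminf (\<lambda>k. norm (b k)) / (1 - norm z)"
  have xk: "norm (x ^ k) \<le> 1" for k
    using x by (simp add: norm_power power_le_one)
  have xz: "norm (x ^ k * z) \<le> norm z" for k
    using mult_right_mono[OF xk norm_ge_zero, of k z] by (simp add: norm_mult)
  have ne: "1 - x ^ k * z \<noteq> 0" for k
    using xz[of k] z by auto
  have bnd: "norm (b k / (1 - x ^ k * z) * (x ^ k * z) ^ J)
      \<le> norm (b k) * (norm z ^ J / (1 - norm z))" for k J
  proof -
    have "norm (1 - x ^ k * z) \<ge> 1 - norm z"
      using norm_triangle_ineq2[of 1 "x ^ k * z"] xz[of k] by simp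
    hence "norm (x ^ k * z) ^ J / norm (1 - x ^ k * z) \<le> norm z ^ J / (1 - norm z)"
      using xz[of k] z by (intro frac_le power_mono) auto
    from mult_left_mono[OF this, of "norm (b k)"] show ?thesis
      by (simp add: norm_mult norm_divide norm_power)
  qed
  have sumb: "summable (\<lambda>k. norm (b k) * c)" for c
    using b by (rule summable_mult2)
  have s1: "summable (\<lambda>k. b k / (1 - x ^ k * z) * (x ^ k * z) ^ J)" for J
    by (rule summable_comparison_test'[OF sumb bnd])
  have s2: "summable (\<lambda>k. b k * (x ^ k) ^ j)" for j
  proof (rule summable_comparison_test'[OF b])
    show "norm (b k * (x ^ k) ^ j) \<le> norm (b k)" for k
      using mult_left_mono[OF power_le_one[OF norm_ge_zero xk[of k], of j], of "norm (b k)"]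
      by (simp add: norm_mult norm_power)
  qed
  have rem: "suminf (\<lambda>k. b k / (1 - x ^ k * z)) - (\<Sum>j<J. suminf (\<lambda>k. b k * (x ^ k) ^ j) * z ^ j)
     = suminf (\<lambda>k. b k / (1 - x ^ k * z) * (x ^ k * z) ^ J)" for J
  proof -
    have "(\<Sum>j<J. suminf (\<lambda>k. b k * (x ^ k) ^ j) * z ^ j)
        = (\<Sum>j<J. suminf (\<lambda>k. b k * (x ^ k) ^ j * z ^ j))"
      using s2 by (simp add: suminf_mult2)
    also have "\<dots> = suminf (\<lambda>k. \<Sum>j<J. b k * (x ^ k) ^ j * z ^ j)"
      using s2 by (intro suminf_sum[symmetric] summable_mult2)
    also have "(\<lambda>k. \<Sum>j<J. b k * (x ^ k) ^ j * z ^ j)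
        = (\<lambda>k. b k / (1 - x ^ k * z) - b k / (1 - x ^ k * z) * (x ^ k * z) ^ J)"
    proof
      fix k
      have "(\<Sum>j<J. b k * (x ^ k) ^ j * z ^ j) = b k * (\<Sum>j<J. (x ^ k * z) ^ j)"
        by (simp add: sum_distrib_left power_mult_distrib mult_ac)
      also have "(\<Sum>j<J. (x ^ k * z) ^ j) = (1 - (x ^ k * z) ^ J) / (1 - x ^ k * z)"
        using ne[of k] one_diff_power_eq[of "x ^ k * z" J] by (simp add: field_simps)
      finally show "(\<Sum>j<J. b k * (x ^ k) ^ j * z ^ j)
          = b k / (1 - x ^ k * z) - b k / (1 - x ^ k * z) * (x ^ k * z) ^ J"
        by (simp add: right_diff_distrib diff_divide_distrib)
    qed
    also have "suminf (\<lambda>k. b k / (1 - x ^ k * z) - b k / (1 - x ^ k * z) * (x ^ k * z) ^ J)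
        = suminf (\<lambda>k. b k / (1 - x ^ k * z)) - suminf (\<lambda>k. b k / (1 - x ^ k * z) * (x ^ k * z) ^ J)"
      using s1[of 0] s1[of J] by (intro suminf_diff[symmetric]) auto
    finally show ?thesis by simp
  qed
  have "norm ((\<Sum>j<J. suminf (\<lambda>k. b k * (x ^ k) ^ j) * z ^ j) - suminf (\<lambda>k. b k / (1 - x ^ k * z)))
      \<le> C * norm z ^ J" for J
  proof -
    have "norm (suminf (\<lambda>k. b k / (1 - x ^ k * z) * (x ^ k * z) ^ J))
        \<le> suminf (\<lambda>k. norm (b k) * (norm z ^ J / (1 - norm z)))"
      by (rule norm_suminf_le[OF bnd sumb])
    also have "\<dots> = C * norm z ^ J"
      using suminf_mult2[OF b, of "norm z ^ J / (1 - norm z)"] by (simp add: C_def)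
    finally show ?thesis
      by (subst norm_minus_commute, subst rem)
  qed
  moreover have "(\<lambda>J. C * norm z ^ J) \<longlonglongrightarrow> 0"
    using z by (intro tendsto_mult_right_zero LIMSEQ_power_zero) auto
  ultimately have "(\<lambda>J. (\<Sum>j<J. suminf (\<lambda>k. b k * (x ^ k) ^ j) * z ^ j)
      - suminf (\<lambda>k. b k / (1 - x ^ k * z))) \<longlonglongrightarrow> 0"
    by (rule Lim_null_comparison[OF always_eventually[OF allI]])
  thus ?thesis
    unfolding sums_def by (rule LIM_zero_cancel)
qed

text \<open>
  Writing \<open>\<phi>(u) = \<Sum>\<^sub>k c\<^sub>k u\<^sup>k\<close> near \<open>0\<close> and summing over \<open>r\<close> first turns \<open>\<Sum>\<^sub>r \<phi>(x\<^bsup>r+1\<^esup>) z\<^sup>r\<close> into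
  \<open>\<Sum>\<^sub>k c\<^sub>k x\<^sup>k / (1 - x\<^sup>k z)\<close>, which makes sense wherever no denominator vanishes. The Taylor series
  represents \<open>\<phi>\<close> only close to \<open>0\<close>; therefore the first \<open>N\<close> terms, which form a polynomial in \<open>z\<close>,
  are split off and only the terms with small \<open>x\<^bsup>r+1\<^esup>\<close> are rearranged.
\<close>

lemma geometric_samples_continuation:
  fixes \<phi> :: "complex \<Rightarrow> complex" and x :: complex
  assumes \<phi>: "\<phi> analytic_on {0}" and x: "norm x < 1"
    and S: "open S" "\<And>z k. z \<in> S \<Longrightarrow> x ^ k * z \<noteq> 1"
  obtains h where "h holomorphic_on S"
    "\<And>z. norm z < 1 \<Longrightarrow> (\<lambda>r. \<phi> (x ^ Suc r) * z ^ r) sums h z"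
proof -
  define F where "F = fps_expansion \<phi> 0"
  have F: "\<phi> has_fps_expansion F"
    unfolding F_def using \<phi> by (rule analytic_at_imp_has_fps_expansion_0)
  then have rad: "fps_conv_radius F > 0" and ev: "\<forall>\<^sub>F u in nhds 0. eval_fps F u = \<phi> u"
    by (auto simp: has_fps_expansion_def)
  from ev obtain e where e: "e > 0" "\<And>u. norm u < e \<Longrightarrow> eval_fps F u = \<phi> u"
    by (auto simp: eventually_nhds_metric)
  from rad obtain R :: real where R: "R > 0" "R < fps_conv_radius F"
    using ereal_dense2[of 0] by auto
  define \<rho> where "\<rho> = min e R"
  have "(\<lambda>n. norm x ^ n) \<longlonglongrightarrow> 0"
    using x by (intro LIMSEQ_power_zero) auto
  hence "\<forall>\<^sub>F n in sequentially. norm x ^ n < \<rho>"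
    by (rule order_tendstoD) (use e R in \<open>auto simp: \<rho>_def\<close>)
  then obtain N where "\<And>n. n \<ge> N \<Longrightarrow> norm x ^ n < \<rho>"
    by (auto simp: eventually_sequentially)
  hence N: "norm (x ^ n) < \<rho>" if "n \<ge> N" for n
    using that by (simp add: norm_power)
  have small: "norm (x ^ n) < fps_conv_radius F" if "n \<ge> N" for n
    using N[OF that] R(2) unfolding \<rho>_def by (metis ereal_less_eq(3) less_eq_real_def min_less_iff_conj order_le_less_trans)
  \<comment> \<open>The Lambert coefficients of the series without its first \<open>N\<close> terms, divided by \<open>z\<^sup>N\<close>.\<close>
  define b where "b k = fps_nth F k * (x ^ Suc N) ^ k" for k
  have b: "summable (\<lambda>k. norm (b k))"
    unfolding b_def by (rule norm_summable_fps) (rule small, simp)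
  define g where "g z = suminf (\<lambda>k. b k / (1 - x ^ k * z))" for z
  have coeff: "suminf (\<lambda>k. b k * (x ^ k) ^ j) = \<phi> (x ^ Suc (j + N))" for j
  proof -
    have "(x ^ Suc N) ^ k * (x ^ k) ^ j = (x ^ Suc (j + N)) ^ k" for k
      unfolding power_mult[symmetric] power_add[symmetric] by (simp add: algebra_simps)
    hence "suminf (\<lambda>k. b k * (x ^ k) ^ j) = eval_fps F (x ^ Suc (j + N))"
      unfolding eval_fps_def b_def by (intro suminf_cong) (simp only: mult.assoc)
    also have "\<dots> = \<phi> (x ^ Suc (j + N))"
      using N[of "Suc (j + N)"] by (intro e) (simp add: \<rho>_def)
    finally show ?thesis .
  qed
  show ?thesis
  proof
    show "(\<lambda>z. z ^ N * g z + (\<Sum>r<N. \<phi> (x ^ Suc r) * z ^ r)) holomorphic_on S"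
      unfolding g_def by (intro holomorphic_intros holomorphic_lambert_series b x S)
    fix z :: complex assume z: "norm z < 1"
    have "(\<lambda>j. \<phi> (x ^ Suc (j + N)) * z ^ j) sums g z"
      using lambert_series_power_series[OF b less_imp_le[OF x] z] by (simp only: coeff g_def)
    hence "(\<lambda>j. z ^ N * (\<phi> (x ^ Suc (j + N)) * z ^ j)) sums (z ^ N * g z)"
      by (rule sums_mult)
    hence "(\<lambda>j. \<phi> (x ^ Suc (j + N)) * z ^ (j + N)) sums (z ^ N * g z)"
      by (simp add: power_add mult_ac)
    thus "(\<lambda>r. \<phi> (x ^ Suc r) * z ^ r) sums (z ^ N * g z + (\<Sum>r<N. \<phi> (x ^ Suc r) * z ^ r))"
      using sums_iff_shift[of "\<lambda>r. \<phi> (x ^ Suc r) * z ^ r" N "z ^ N * g z"] by blast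
  qed
qed

text \<open>
  With \<open>D\<close> the largest exponent and \<open>x = 1/q\<close>,
  \<open>ln (\<Sum>\<^sub>d q\<^bsup>rd\<^esup>) = r D ln q + ln (\<Sum>\<^sub>d (x\<^sup>r)\<^bsup>D-d\<^esup>)\<close>. The first term contributes a double pole at
  \<open>z = 1\<close>. The second one is a function of \<open>x\<^sup>r\<close> that is analytic at \<open>0\<close>, because the polynomial inside
  the logarithm takes a positive integer value there, so the preceding lemma applies to it.
\<close>

lemma log_polynomial_series_continuation:
  fixes ds :: "nat list" and q :: real
  assumes ds: "ds \<noteq> []" and q: "q > 1"
    and S: "open S" "\<And>z k. z \<in> S \<Longrightarrow> z \<noteq> of_real q ^ k"
  obtains h where "h holomorphic_on S"
    "\<And>z. norm z < 1 \<Longrightarrow> (\<lambda>r. of_real (ln (\<Sum>d\<leftarrow>ds. (q ^ Suc r) ^ d)) * z ^ r) sums h z"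
proof -
  define D where "D = Max (set ds)"
  have D: "D \<in> set ds" "\<And>d. d \<in> set ds \<Longrightarrow> d \<le> D"
    using ds by (auto simp: D_def)
  define P :: "real \<Rightarrow> real" where "P u = (\<Sum>d\<leftarrow>ds. u ^ (D - d))" for u
  define \<phi> :: "complex \<Rightarrow> complex" where "\<phi> u = Ln (\<Sum>d\<leftarrow>ds. u ^ (D - d))" for u
  define x where "x = inverse q"
  have x: "0 < x" "x < 1" using q by (auto simp: x_def field_simps)
  have P_pos: "P u > 0" if "u \<ge> 0" for u
  proof -
    \<comment> \<open>The summand with \<open>d = D\<close> equals \<open>1\<close>.\<close>
    have "1 \<le> P u"
      unfolding P_def using D(1) that
      by (intro member_le_sum_list[of 1, THEN order_trans[rotated]])
         (auto simp: image_iff intro!: bexI[of _ D] sum_list_nonneg)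
    thus ?thesis by simp
  qed
  have P_complex: "(\<Sum>d\<leftarrow>ds. of_real u ^ (D - d)) = complex_of_real (P u)" for u
    unfolding P_def by (induction ds) auto
  have \<phi>_real: "\<phi> (of_real u) = of_real (ln (P u))" if "u \<ge> 0" for u
    unfolding \<phi>_def using P_pos[OF that] by (simp only: P_complex Ln_of_real)
  have "\<phi> analytic_on {0}"
  proof -
    have "(\<lambda>u. \<Sum>d\<leftarrow>ds. u ^ (D - d)) analytic_on {0::complex}"
      by (induction ds) (auto intro!: analytic_intros)
    moreover have "(\<Sum>d\<leftarrow>ds. (0::complex) ^ (D - d)) \<notin> \<real>\<^sub>\<le>\<^sub>0"
      using P_complex[of 0] P_pos[of 0] by simp
    ultimately show ?thesis
      unfolding \<phi>_def by (intro analytic_on_ln) auto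
  qed
  moreover have "(of_real x) ^ k * z \<noteq> 1" if "z \<in> S" for z k
    using S(2)[OF that, of k] q by (auto simp: x_def field_simps)
  ultimately obtain h0 where h0: "h0 holomorphic_on S"
    "\<And>z. norm z < 1 \<Longrightarrow> (\<lambda>r. \<phi> (of_real x ^ Suc r) * z ^ r) sums h0 z"
    using geometric_samples_continuation[of \<phi> "of_real x" S] x S(1) by auto
  have term_eq: "ln (\<Sum>d\<leftarrow>ds. (q ^ r) ^ d) = real r * (real D * ln q) + ln (P (x ^ r))" for r
  proof -
    have "(\<Sum>d\<leftarrow>ds. (q ^ r) ^ d) = (\<Sum>d\<leftarrow>ds. (q ^ r) ^ D * (x ^ r) ^ (D - d))"
    proof (intro arg_cong[of _ _ sum_list] map_cong refl)
      fix d assume "d \<in> set ds"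
      hence "(q ^ r) ^ D = (q ^ r) ^ d * (q ^ r) ^ (D - d)"
        using D(2) by (simp flip: power_add)
      thus "(q ^ r) ^ d = (q ^ r) ^ D * (x ^ r) ^ (D - d)"
        using q by (simp add: x_def power_inverse)
    qed
    also have "\<dots> = (q ^ r) ^ D * P (x ^ r)"
      by (simp add: P_def sum_list_const_mult)
    finally show ?thesis
      using q P_pos[of "x ^ r"] x by (simp add: ln_mult ln_realpow)
  qed
  define c where "c = complex_of_real (real D * ln q)"
  show ?thesis
  proof
    show "(\<lambda>z. c * (1 / (1 - z)\<^sup>2) + h0 z) holomorphic_on S"
      using S(2)[of _ 0] by (intro holomorphic_intros h0) auto
    fix z :: complex assume z: "norm z < 1"
    have "(\<lambda>r. c * (of_nat (Suc r) * z ^ r) + \<phi> (of_real x ^ Suc r) * z ^ r)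
        sums (c * (1 / (1 - z)\<^sup>2) + h0 z)"
      by (intro sums_add sums_mult geometric_deriv_sums h0 z)
    moreover have "c * (of_nat (Suc r) * z ^ r) + \<phi> (of_real x ^ Suc r) * z ^ r
        = of_real (ln (\<Sum>d\<leftarrow>ds. (q ^ Suc r) ^ d)) * z ^ r" for r
      using \<phi>_real[of "x ^ Suc r"] x
      by (simp only: term_eq of_real_power zero_le_power less_imp_le) (simp add: c_def algebra_simps)
    ultimately show "(\<lambda>r. of_real (ln (\<Sum>d\<leftarrow>ds. (q ^ Suc r) ^ d)) * z ^ r)
        sums (c * (1 / (1 - z)\<^sup>2) + h0 z)"
      by simp
  qed
qed

section \<open>Continuation of the multiplicative zeta function\<close>

text \<open>
  The function \<open>h\<close> continues the derivative of the exponent \<open>\<Sum>\<^sub>r a\<^sub>r z\<^sup>r / r\<close>. On a simply connected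
  domain \<open>h\<close> has a primitive, and the exponential of the primitive that vanishes at \<open>0\<close> is the required
  continuation. The result is multivalued because these primitives, taken on different domains, may
  disagree where the domains overlap.
\<close>

lemma exp_primitive_multivalued_continuation:
  fixes a :: "nat \<Rightarrow> complex"
  assumes \<Delta>: "closed \<Delta>" "discrete \<Delta>" "0 \<notin> \<Delta>"
    and h: "h holomorphic_on - \<Delta>" "\<And>z. norm z < 1 \<Longrightarrow> (\<lambda>r. a (Suc r) * z ^ r) sums h z"
  shows "has_multivalued_continuation
           (fps_compose (fps_exp 1) (Abs_fps (\<lambda>r. if r = 0 then 0 else a r / of_nat r)))"
proof -
  define L where "L = Abs_fps (\<lambda>r. if r = 0 then 0 else a r / of_nat r)"
  have exp: "\<exists>g. g holomorphic_on U \<and> g has_fps_expansion fps_compose (fps_exp 1) L"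
    if U: "open U" "simply_connected U" "0 \<in> U" "U \<subseteq> - \<Delta>" for U
  proof -
    have "h holomorphic_on U"
      using h(1) U(4) by (rule holomorphic_on_subset)
    then obtain G where G: "\<And>z. z \<in> U \<Longrightarrow> (G has_field_derivative h z) (at z)"
      using simply_connected_eq_global_primitive[OF U(1)] U(2) by blast
    define H where "H z = G z - G 0" for z
    have H: "(H has_field_derivative h z) (at z)" if "z \<in> U" for z
      unfolding H_def using G[OF that] by (auto intro!: derivative_eq_intros)
    have hol: "H holomorphic_on U"
      using H U(1) by (auto simp: holomorphic_on_open)
    hence H_exp: "H has_fps_expansion fps_expansion H 0"
      using U(1,3) by (intro analytic_at_imp_has_fps_expansion_0) (auto simp: analytic_at)
    have "h has_fps_expansion fps_deriv L"
    proof (rule has_fps_expansionI)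
      have "\<forall>\<^sub>F z in nhds 0. z \<in> ball (0::complex) 1"
        by (intro eventually_nhds_in_open) auto
      thus "\<forall>\<^sub>F z in nhds 0. (\<lambda>r. fps_nth (fps_deriv L) r * z ^ r) sums h z"
      proof eventually_elim
        case (elim z)
        moreover have "fps_nth (fps_deriv L) r = a (Suc r)" for r
          by (simp add: L_def del: of_nat_Suc)
        ultimately show ?case using h(2)[of z] by simp
      qed
    qed
    moreover have "\<forall>\<^sub>F z in nhds 0. h z = deriv H z"
      using eventually_nhds_in_open[OF U(1,3)] by eventually_elim (use H DERIV_imp_deriv in force)
    ultimately have "deriv H has_fps_expansion fps_deriv L"
      by (simp cong: has_fps_expansion_cong)
    hence "fps_deriv (fps_expansion H 0) = fps_deriv L"
      using has_fps_expansion_deriv[OF H_exp] by (rule fps_expansion_unique_complex[rotated])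
    moreover have "fps_nth (fps_expansion H 0) 0 = fps_nth L 0"
      using has_fps_expansion_imp_0_eq_fps_nth_0[OF H_exp] by (simp add: H_def L_def)
    ultimately have "fps_expansion H 0 = L"
      by (simp add: fps_deriv_eq_iff)
    hence "H has_fps_expansion L" using H_exp by simp
    hence "(exp \<circ> H) has_fps_expansion fps_compose (fps_exp 1) L"
      by (intro has_fps_expansion_compose has_fps_expansion_exp1) (auto simp: L_def)
    moreover have "(exp \<circ> H) holomorphic_on U"
      unfolding o_def by (intro holomorphic_intros hol)
    ultimately show ?thesis by blast
  qed
  \<comment> \<open>A small disc serves as a domain on which to read off that the radius of convergence is positive.\<close>
  obtain e where "e > 0" "ball 0 e \<subseteq> - \<Delta>"
    using \<Delta>(1,3) by (metis ComplI open_Compl open_contains_ball)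
  with exp[of "ball 0 e"] have "fps_conv_radius (fps_compose (fps_exp 1) L) > 0"
    by (auto simp: has_fps_expansion_def convex_imp_simply_connected)
  moreover have "\<exists>g. g holomorphic_on U \<and> (\<forall>\<^sub>F z in nhds 0. g z = eval_fps (fps_compose (fps_exp 1) L) z)"
    if "open U \<and> connected U \<and> simply_connected U \<and> 0 \<in> U \<and> U \<subseteq> - \<Delta>" for U
    using exp[of U] that by (auto simp: has_fps_expansion_def eq_commute)
  ultimately show ?thesis
    unfolding has_multivalued_continuation_def L_def using \<Delta> by blast
qed

lemma powers_closed_discrete:
  fixes q :: nat
  assumes "q > 0"
  shows "closed (range (\<lambda>k. of_nat q ^ k :: complex))" "discrete (range (\<lambda>k. of_nat q ^ k :: complex))"
    "0 \<notin> range (\<lambda>k. of_nat q ^ k :: complex)"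
proof -
  have "dist x y \<ge> 1" if "x \<in> \<int>" "y \<in> \<int>" "x \<noteq> y" for x y :: complex
    using that by (elim Ints_cases) (auto simp: dist_of_int)
  hence "uniform_discrete (\<int> :: complex set)"
    unfolding uniform_discrete_def by (intro exI[of _ 1]) force
  moreover have "range (\<lambda>k. of_nat q ^ k :: complex) \<subseteq> \<int>" by auto
  ultimately have "uniform_discrete (range (\<lambda>k. of_nat q ^ k :: complex))"
    by (rule uniform_discrete_subset)
  thus "closed (range (\<lambda>k. of_nat q ^ k :: complex))" "discrete (range (\<lambda>k. of_nat q ^ k :: complex))"
    by (rule uniform_discrete_imp_closed uniform_discrete_imp_discrete)+
  show "0 \<notin> range (\<lambda>k. of_nat q ^ k :: complex)"
    using assms by auto
qed

theorem corollary5p8: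
  fixes V :: "'k::{field,finite} alg_closure ppoint set" and n :: nat
  assumes "projective_variety n V"
    and "smooth n V"
    and "geometrically_connected n V"
    and "cellular n V"
  shows "has_multivalued_continuation (Zlog V)"
proof -
  define q where "q = CARD('k)"
  define \<Delta> where "\<Delta> = range (\<lambda>k. of_nat q ^ k :: complex)"
  have q: "q \<ge> 2" unfolding q_def by (rule card_field_ge_2)
  have \<Delta>: "closed \<Delta>" "discrete \<Delta>" "0 \<notin> \<Delta>"
    unfolding \<Delta>_def using q by (intro powers_closed_discrete; simp)+
  obtain ds where c: "counted_by_cells V ds"
    using counted_by_cells_cellular[OF assms(4)] by blast
  have "V \<noteq> {}"
    using assms(3) by (simp add: geometrically_connected_def)
  hence ds: "ds \<noteq> []"
    using c by (auto simp: counted_by_cells_def)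
  define a where "a r = complex_of_real (ln (real (card (rational_points r V))))" for r
  obtain h where h: "h holomorphic_on - \<Delta>"
    "\<And>z. norm z < 1 \<Longrightarrow> (\<lambda>r. of_real (ln (\<Sum>d\<leftarrow>ds. (real q ^ Suc r) ^ d)) * z ^ r) sums h z"
    by (rule log_polynomial_series_continuation[OF ds, of "real q" "- \<Delta>"])
       (use q \<Delta>(1) in \<open>auto simp: \<Delta>_def\<close>)
  have "real (card (rational_points (Suc r) V)) = (\<Sum>d\<leftarrow>ds. (real q ^ Suc r) ^ d)" for r
  proof -
    have "real (\<Sum>d\<leftarrow>es. (q ^ Suc r) ^ d) = (\<Sum>d\<leftarrow>es. (real q ^ Suc r) ^ d)" for es
      by (induction es) auto
    thus ?thesis using c by (simp add: counted_by_cells_def q_def)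
  qed
  with h(2) have "(\<lambda>r. a (Suc r) * z ^ r) sums h z" if "norm z < 1" for z
    using that by (simp add: a_def)
  from exp_primitive_multivalued_continuation[OF \<Delta> h(1) this]
  show ?thesis
    by (simp add: Zlog_def a_def cong: if_cong)
qed

end
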